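(* Let $M,N\ge1$, $t\in[0,1)$, $a\in(0,1)^M$, $b\in(0,1)^N$ be fixed. For $u\in[0,1)$ let $(S_1,S_2)\in\{0,1\}^M\times\{0,1\}^N$ be the outgoing arrow configuration of the quasi-periodic stochastic six vertex model with parameters $u,t$ and rapidities $a,b$. As $u\to1$, $(S_1,S_2)$ converges in distribution to the stationary distribution for the periodic six vertex model (with parameters $t,a,b$) conditioned to have $N$ arrows.
   Context: Stochastic six vertex model on an $M\times N$ rectangle with column rapidities $a_1,\dots,a_M$ (left to right) and row rapidities $b_1,\dots,b_N$ (bottom to top): arrows travel up and right along lattice edges, at most one arrow per edge; incoming arrows at the bottom and left boundary are specified; the probability of a configuration is the product of vertex weights. With $\mathbf p_{i,j}=\frac{1-a_ib_j}{1-ta_ib_j}$, the weight at the vertex in column $i$, row $j$ is: (no arrows in or out) $1$; (arrows on all four edges) $1$; (only a left incoming arrow) it exits right with weight $\mathbf p_{i,j}$ and up with weight $1-\mathbf p_{i,j}$; (only a bottom incoming arrow) it exits up with weight $t\mathbf p_{i,j}$ and right with weight $1-t\mathbf p_{i,j}$. Quasi-periodic model of length $L$ with parameter $u$: it consists of $L$ six vertex models on $M\times N$ rectangles, the $l$th one ($l=1,\dots,L$) having column rapidities $u^{l-1}a_1,\dots,u^{l-1}a_M$ and row rapidities $b_1,\dots,b_N$. For $l\ge2$, arrows exiting the top of column $i$ of the $l$th rectangle enter the bottom of column $i$ of the $(l-1)$th, and arrows exiting the right of row $j$ of the $l$th rectangle enter the left of row $j$ of the $(l-1)$th. The input to the $L$th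 rectangle has no arrows at the bottom and an arrow in every row on the left (so there are $N$ arrows in total). $S_1,S_2$ are the indicator vectors of arrows exiting the top and right of the $1$st rectangle. The quasi-periodic stochastic six vertex model ($u\in[0,1)$) is the limit in distribution as $L\to\infty$ (the limit exists). Periodic six vertex model: the discrete-time Markov chain on $\{0,1\}^{M+N}$ in which one step takes a state (arrows at $M$ bottom and $N$ left incoming edges), runs one $M\times N$ stochastic six vertex model with column rapidities $a$ and row rapidities $b$, and returns the arrow configuration on the $M$ top and $N$ right outgoing edges (top of column $i$ becoming the bottom of column $i$, right of row $j$ becoming the left of row $j$). The number of arrows is preserved; the stationary distribution conditioned to have $N$ arrows is the stationary distribution of this chain restricted to states with exactly $N$ arrows. *)

theory Defs
  imports "HOL-Probability.Probability"
begin

text \<open>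
  A boundary state \<open>(A, B)\<close> is an element of \<open>{0,1}^M \<times> {0,1}^N\<close>, each \<open>0/1\<close>-vector being encoded by
  its support: \<open>A \<subseteq> {1..M}\<close> is the set of columns carrying an arrow across a horizontal boundary
  side, and \<open>B \<subseteq> {1..N}\<close> the set of rows carrying an arrow across a vertical boundary side.
\<close>

type_synonym arrows = "nat set \<times> nat set"

definition boundary_states :: "nat \<Rightarrow> nat \<Rightarrow> arrows set" where
  "boundary_states M N = Pow {1..M} \<times> Pow {1..N}"

definition num_arrows :: "arrows \<Rightarrow> nat" where
  "num_arrows s = card (fst s) + card (snd s)"

definition right_prob :: "real \<Rightarrow> real \<Rightarrow> real \<Rightarrow> real" where
  "right_prob t x y = (1 - x * y) / (1 - t * x * y)"

text \<open>Arguments after the rapidities: arrow on the bottom, left (incoming), top, right (outgoing) edge.\<close>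

fun vertex_weight ::
  "real \<Rightarrow> real \<Rightarrow> real \<Rightarrow> bool \<Rightarrow> bool \<Rightarrow> bool \<Rightarrow> bool \<Rightarrow> real" where
  "vertex_weight t x y False False False False = 1"
| "vertex_weight t x y True  True  True  True  = 1"
| "vertex_weight t x y False True  False True  = right_prob t x y"
| "vertex_weight t x y False True  True  False = 1 - right_prob t x y"
| "vertex_weight t x y True  False True  False = t * right_prob t x y"
| "vertex_weight t x y True  False False True  = 1 - t * right_prob t x y"
| "vertex_weight t x y _ _ _ _ = 0"

text \<open>
  A configuration on the \<open>M \<times> N\<close> rectangle is recorded by its edges that leave a vertex:
  \<open>(i, j) \<in> V\<close> iff there is an arrow on the edge leaving the vertex in column \<open>i\<close>, row \<open>j\<close> upwards,
  and \<open>(i, j) \<in> H\<close> iff there is one on the edge leaving it to the right. The remaining edges are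
  the incoming boundary edges, which are specified by the input state.
\<close>

type_synonym config = "(nat \<times> nat) set \<times> (nat \<times> nat) set"

definition vertices :: "nat \<Rightarrow> nat \<Rightarrow> (nat \<times> nat) set" where
  "vertices M N = {1..M} \<times> {1..N}"

definition configs :: "nat \<Rightarrow> nat \<Rightarrow> config set" where
  "configs M N = Pow (vertices M N) \<times> Pow (vertices M N)"

definition bottom_arrow :: "arrows \<Rightarrow> config \<Rightarrow> nat \<times> nat \<Rightarrow> bool" where
  "bottom_arrow s c = (\<lambda>(i, j). if j = 1 then i \<in> fst s else (i, j - 1) \<in> fst c)"

definition left_arrow :: "arrows \<Rightarrow> config \<Rightarrow> nat \<times> nat \<Rightarrow> bool" where
  "left_arrow s c = (\<lambda>(i, j). if i = 1 then j \<in> snd s else (i - 1, j) \<in> snd c)"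

definition weight_at ::
  "real \<Rightarrow> (nat \<Rightarrow> real) \<Rightarrow> (nat \<Rightarrow> real) \<Rightarrow> arrows \<Rightarrow> config \<Rightarrow> nat \<times> nat \<Rightarrow> real" where
  "weight_at t a b s c v =
     vertex_weight t (a (fst v)) (b (snd v))
       (bottom_arrow s c v) (left_arrow s c v) (v \<in> fst c) (v \<in> snd c)"

definition config_prob ::
  "nat \<Rightarrow> nat \<Rightarrow> real \<Rightarrow> (nat \<Rightarrow> real) \<Rightarrow> (nat \<Rightarrow> real) \<Rightarrow> arrows \<Rightarrow> config \<Rightarrow> real" where
  "config_prob M N t a b s c =
     (if c \<in> configs M N then \<Prod>v\<in>vertices M N. weight_at t a b s c v else 0)"

text \<open>
  The law of the configuration. The lemma \<open>pmf_config_pmf\<close> below shows that these probabilities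
  do define a distribution in the relevant parameter range.
\<close>

definition config_pmf ::
  "nat \<Rightarrow> nat \<Rightarrow> real \<Rightarrow> (nat \<Rightarrow> real) \<Rightarrow> (nat \<Rightarrow> real) \<Rightarrow> arrows \<Rightarrow> config pmf" where
  "config_pmf M N t a b s = embed_pmf (config_prob M N t a b s)"

definition outgoing :: "nat \<Rightarrow> nat \<Rightarrow> config \<Rightarrow> arrows" where
  "outgoing M N c = ({i \<in> {1..M}. (i, N) \<in> fst c}, {j \<in> {1..N}. (M, j) \<in> snd c})"

definition six_vertex ::
  "nat \<Rightarrow> nat \<Rightarrow> real \<Rightarrow> (nat \<Rightarrow> real) \<Rightarrow> (nat \<Rightarrow> real) \<Rightarrow> arrows \<Rightarrow> arrows pmf" where
  "six_vertex M N t a b s = map_pmf (outgoing M N) (config_pmf M N t a b s)"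

text \<open>
  State spaces here are finite and discrete, so every real function on them is continuous and
  the test functions are all bounded functions.
\<close>

definition converges_in_distribution :: "('i \<Rightarrow> 's pmf) \<Rightarrow> 's pmf \<Rightarrow> 'i filter \<Rightarrow> bool" where
  "converges_in_distribution p q F \<longleftrightarrow>
     (\<forall>f :: 's \<Rightarrow> real. bounded (range f) \<longrightarrow>
        ((\<lambda>i. measure_pmf.expectation (p i) f) \<longlongrightarrow> measure_pmf.expectation q f) F)"

text \<open>
  \<open>quasi_periodic_from M N t a b u l s\<close> is the law of the output of the first rectangle when the
  \<open>l\<close>-th rectangle receives input \<open>s\<close>. The recursion peels off the \<open>(l+1)\<close>-st rectangle, whose
  column rapidities are \<open>u\<^sup>l a\<^sub>i\<close> and whose output is the input of the \<open>l\<close>-th.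
\<close>

primrec quasi_periodic_from ::
  "nat \<Rightarrow> nat \<Rightarrow> real \<Rightarrow> (nat \<Rightarrow> real) \<Rightarrow> (nat \<Rightarrow> real) \<Rightarrow> real \<Rightarrow> nat \<Rightarrow> arrows \<Rightarrow> arrows pmf" where
  "quasi_periodic_from M N t a b u 0 s = return_pmf s"
| "quasi_periodic_from M N t a b u (Suc l) s =
     bind_pmf (six_vertex M N t (\<lambda>i. u ^ l * a i) b s) (quasi_periodic_from M N t a b u l)"

definition quasi_periodic_length ::
  "nat \<Rightarrow> nat \<Rightarrow> real \<Rightarrow> (nat \<Rightarrow> real) \<Rightarrow> (nat \<Rightarrow> real) \<Rightarrow> real \<Rightarrow> nat \<Rightarrow> arrows pmf" where
  "quasi_periodic_length M N t a b u L = quasi_periodic_from M N t a b u L ({}, {1..N})"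

text \<open>
  Both uses of \<open>THE\<close> below (here and in \<open>periodic_stationary\<close>) denote the intended object only
  given existence and uniqueness: of the limit for \<open>0 \<le> u < 1\<close>, and of the stationary law.
\<close>

definition quasi_periodic ::
  "nat \<Rightarrow> nat \<Rightarrow> real \<Rightarrow> (nat \<Rightarrow> real) \<Rightarrow> (nat \<Rightarrow> real) \<Rightarrow> real \<Rightarrow> arrows pmf" where
  "quasi_periodic M N t a b u =
     (THE q. converges_in_distribution (quasi_periodic_length M N t a b u) q sequentially)"

text \<open>The transition kernel of the periodic model is \<open>six_vertex M N t a b\<close> itself.\<close>

definition is_periodic_stationary ::
  "nat \<Rightarrow> nat \<Rightarrow> real \<Rightarrow> (nat \<Rightarrow> real) \<Rightarrow> (nat \<Rightarrow> real) \<Rightarrow> nat \<Rightarrow> arrows pmf \<Rightarrow> bool" where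
  "is_periodic_stationary M N t a b k q \<longleftrightarrow>
     set_pmf q \<subseteq> {s \<in> boundary_states M N. num_arrows s = k} \<and>
     bind_pmf q (six_vertex M N t a b) = q"

definition periodic_stationary ::
  "nat \<Rightarrow> nat \<Rightarrow> real \<Rightarrow> (nat \<Rightarrow> real) \<Rightarrow> (nat \<Rightarrow> real) \<Rightarrow> nat \<Rightarrow> arrows pmf" where
  "periodic_stationary M N t a b k = (THE q. is_periodic_stationary M N t a b k q)"


lemma right_prob_bounds:
  assumes "0 \<le> t" "t < 1" "0 \<le> x * y" "x * y < 1"
  shows "0 \<le> right_prob t x y" "right_prob t x y \<le> 1"
proof -
  have "t * (x * y) \<le> 1 * (x * y)"
    using assms by (intro mult_right_mono) auto
  then have *: "1 - x * y \<le> 1 - t * x * y" by (simp add: mult.assoc)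
  with assms have "0 < 1 - t * x * y" by linarith
  with * assms show "0 \<le> right_prob t x y" "right_prob t x y \<le> 1"
    by (simp_all add: right_prob_def divide_simps)
qed

lemma vertex_weight_nonneg:
  assumes "0 \<le> t" "t < 1" "0 \<le> x * y" "x * y < 1"
  shows "0 \<le> vertex_weight t x y p q r s"
proof -
  note rp = right_prob_bounds[OF assms]
  have "t * right_prob t x y \<le> 1"
    using rp assms by (intro mult_le_one) auto
  then show ?thesis
    using rp assms by (cases p; cases q; cases r; cases s) auto
qed

lemma vertex_weight_sum:
  "vertex_weight t x y p q True True + vertex_weight t x y p q True False +
   vertex_weight t x y p q False True + vertex_weight t x y p q False False = 1"
  by (cases p; cases q) auto

lemma sum_Pow_insert:
  fixes g :: "'a set \<Rightarrow> real"
  assumes "finite P" "x \<notin> P"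
  shows "(\<Sum>V\<in>Pow (insert x P). g V) = (\<Sum>V\<in>Pow P. g V + g (insert x V))"
proof -
  have inj: "inj_on (insert x) (Pow P)"
    using assms(2) by (auto simp: inj_on_def)
  have "(\<Sum>V\<in>Pow (insert x P). g V) = (\<Sum>V\<in>Pow P. g V) + (\<Sum>V\<in>insert x ` Pow P. g V)"
    unfolding Pow_insert using assms by (intro sum.union_disjoint) auto
  then show ?thesis
    by (simp add: sum.reindex[OF inj] sum.distrib)
qed

lemma sum_weights:
  assumes "finite P" "P \<subseteq> {1..} \<times> {1..}"
  shows "(\<Sum>V\<in>Pow P. \<Sum>H\<in>Pow P. \<Prod>v\<in>P. weight_at t a b s (V, H) v) = 1"
  using assms
proof (induction P rule: finite_ranking_induct[where f = "\<lambda>v. fst v + snd v :: nat"])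
  case empty
  then show ?case by simp
next
  case (insert x P)
  show ?case
  proof (cases "x \<in> P")
    case True
    with insert show ?thesis by (simp add: insert_absorb)
  next
    case False
    let ?w = "\<lambda>V H. weight_at t a b s (V, H)"
    have old: "?w (insert x V) H v = ?w V H v" "?w V (insert x H) v = ?w V H v"
      if "v \<in> P" for V H v
    proof -
      obtain i j k l where ij: "x = (i, j)" and kl: "v = (k, l)" by fastforce
      have "k + l \<le> i + j" using insert.hyps(2)[OF that] ij kl by simp
      moreover have "1 \<le> k" "1 \<le> l" "v \<noteq> x"
        using insert.prems that kl False by auto
      ultimately have pred: "(k, l) \<noteq> x" "(k - Suc 0, l) \<noteq> x" "(k, l - Suc 0) \<noteq> x"
        using ij kl by auto
      have "bottom_arrow s (insert x V, H) v = bottom_arrow s (V, H) v"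
        "left_arrow s (insert x V, H) v = left_arrow s (V, H) v"
        "bottom_arrow s (V, insert x H) v = bottom_arrow s (V, H) v"
        "left_arrow s (V, insert x H) v = left_arrow s (V, H) v"
        "(v \<in> insert x V) = (v \<in> V)" "(v \<in> insert x H) = (v \<in> H)"
        using pred unfolding bottom_arrow_def left_arrow_def kl by auto
      then show "?w (insert x V) H v = ?w V H v" "?w V (insert x H) v = ?w V H v"
        by (simp_all only: weight_at_def fst_conv snd_conv)
    qed
    define p where "p = (\<lambda>V H. \<Prod>v\<in>P. ?w V H v)"
    have p: "p (insert x V) H = p V H" "p V (insert x H) = p V H" for V H
      using old by (auto simp: p_def intro!: prod.cong)
    have new: "?w V H x + ?w V (insert x H) x + (?w (insert x V) H x + ?w (insert x V) (insert x H) x) = 1"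
      if "V \<subseteq> P" "H \<subseteq> P" for V H
    proof -
      obtain i j where ij: "x = (i, j)" by fastforce
      have "1 \<le> i" "1 \<le> j" using insert.prems ij by auto
      define p q where "p = bottom_arrow s (V, H) x" and "q = left_arrow s (V, H) x"
      have in_eq: "bottom_arrow s (V, K) x = p" "bottom_arrow s (insert x V, K) x = p"
        "left_arrow s (W, H) x = q" "left_arrow s (W, insert x H) x = q" for W K
        using \<open>1 \<le> i\<close> \<open>1 \<le> j\<close> by (auto simp: p_def q_def bottom_arrow_def left_arrow_def ij)
      have "x \<notin> V" "x \<notin> H" using that False by auto
      then show ?thesis
        using vertex_weight_sum[of t "a (fst x)" "b (snd x)" p q]
        by (simp add: weight_at_def in_eq)
    qed
    have prod_insert: "(\<Prod>v\<in>insert x P. ?w V H v) = ?w V H x * p V H" for V H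
      using insert.hyps(1) False by (simp add: p_def)
    have "(\<Sum>V\<in>Pow (insert x P). \<Sum>H\<in>Pow (insert x P). \<Prod>v\<in>insert x P. ?w V H v) =
      (\<Sum>V\<in>Pow P. \<Sum>H\<in>Pow P. p V H *
        (?w V H x + ?w V (insert x H) x + (?w (insert x V) H x + ?w (insert x V) (insert x H) x)))"
      unfolding prod_insert sum_Pow_insert[OF insert.hyps(1) False] sum.distrib[symmetric] p
      by (simp add: algebra_simps)
    also have "\<dots> = (\<Sum>V\<in>Pow P. \<Sum>H\<in>Pow P. p V H)"
      by (intro sum.cong refl) (simp add: new)
    also have "\<dots> = 1"
      using insert.IH insert.prems by (simp add: p_def)
    finally show ?thesis .
  qed
qed

lemma pmf_config_pmf:
  assumes "0 \<le> t" "t < 1"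
    and "\<And>i j. i \<in> {1..M} \<Longrightarrow> j \<in> {1..N} \<Longrightarrow> 0 \<le> a i * b j \<and> a i * b j < 1"
  shows "pmf (config_pmf M N t a b s) c = config_prob M N t a b s c"
proof -
  have nonneg: "0 \<le> config_prob M N t a b s d" for d
    using assms
    by (auto simp: config_prob_def weight_at_def vertices_def intro!: prod_nonneg vertex_weight_nonneg)
  have fin: "finite (configs M N)" by (simp add: configs_def vertices_def)
  have "(\<Sum>d\<in>configs M N. config_prob M N t a b s d) =
    (\<Sum>V\<in>Pow (vertices M N). \<Sum>H\<in>Pow (vertices M N). \<Prod>v\<in>vertices M N. weight_at t a b s (V, H) v)"
    by (simp add: config_prob_def configs_def sum.cartesian_product split_def)
  also have "\<dots> = 1"
    by (rule sum_weights) (auto simp: vertices_def)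
  finally have one: "(\<Sum>d\<in>configs M N. config_prob M N t a b s d) = 1" .
  have "(\<integral>\<^sup>+ d. ennreal (config_prob M N t a b s d) \<partial>count_space UNIV) =
    (\<Sum>d\<in>configs M N. ennreal (config_prob M N t a b s d))"
    by (rule nn_integral_count_space'[OF fin]) (auto simp: config_prob_def)
  also have "\<dots> = 1"
    by (simp add: sum_ennreal nonneg one)
  finally show ?thesis
    unfolding config_pmf_def by (intro pmf_embed_pmf nonneg)
qed

end

theory Submission
  imports Defs
begin

text \<open>
  Let \<open>s\<^sub>0 = ({}, {1..N})\<close>. Every state with \<open>N\<close> arrows has as many arrows on the bottom side
  as there are empty rows on the left, so each bottom arrow can turn right into an empty row:
  a single rectangle reaches \<open>s\<^sub>0\<close> with positive probability, and this probability is bounded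
  below uniformly when the column rapidities are multiplied by \<open>v \<in> [0,1]\<close>. By Doeblin's argument the
  first \<open>L\<close> rectangles forget their input at a geometric rate that does not depend on
  \<open>u \<in> [0,1]\<close>. Hence the limit \<open>L \<rightarrow> \<infinity>\<close> is uniform in \<open>u \<in> [0,1]\<close>, the limiting expectations are
  continuous on \<open>[0,1]\<close>, and at \<open>u = 1\<close> the quasi-periodic model is the periodic chain itself,
  whose limit law is the stationary one.
\<close>

section \<open>Distributions on finite sets\<close>

lemma expectation_bind_finite:
  fixes f :: "'b \<Rightarrow> real"
  assumes "finite A" "set_pmf p \<subseteq> A" "\<And>x. x \<in> A \<Longrightarrow> finite (set_pmf (K x))"
  shows "measure_pmf.expectation (bind_pmf p K) f
    = measure_pmf.expectation p (\<lambda>x. measure_pmf.expectation (K x) f)"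
  using assms
  by (subst pmf_expectation_bind[of A], simp_all) (subst integral_measure_pmf[of A p], auto)

lemma sum_pmf_finite_support:
  assumes "finite A" "set_pmf p \<subseteq> A"
  shows "(\<Sum>x\<in>A. pmf p x) = 1"
  using assms by (simp add: sum_pmf_eq_1)

lemma expectation_indicator_singleton:
  "measure_pmf.expectation p (indicator {x}) = pmf p x"
  by (simp add: measure_pmf_single)

lemma pmf_eq_if_expectation_eq:
  fixes p q :: "'a pmf"
  assumes "\<And>f :: 'a \<Rightarrow> real. bounded (range f) \<Longrightarrow>
    measure_pmf.expectation p f = measure_pmf.expectation q f"
  shows "p = q"
proof (rule pmf_eqI)
  fix x
  have "bounded (range (indicator {x} :: 'a \<Rightarrow> real))"
    by (auto simp: bounded_iff indicator_def intro!: exI[of _ 1])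
  from assms[OF this] show "pmf p x = pmf q x"
    by (simp only: expectation_indicator_singleton)
qed

section \<open>Limits in distribution\<close>

lemma converges_in_distribution_unique:
  assumes "converges_in_distribution p q F" "converges_in_distribution p q' F" "F \<noteq> bot"
  shows "q = q'"
  using assms unfolding converges_in_distribution_def
  by (intro pmf_eq_if_expectation_eq) (blast intro: tendsto_unique)

text \<open>No mass escapes from a finite set: finite sums commute with limits, so the pointwise
  limits of the probabilities still sum to 1, and each expectation is again a finite sum.\<close>

lemma converges_in_distribution_finite_support:
  fixes p :: "nat \<Rightarrow> 'a pmf"
  assumes A: "finite A" "\<And>n. set_pmf (p n) \<subseteq> A"
    and conv: "\<And>x. x \<in> A \<Longrightarrow> convergent (\<lambda>n. pmf (p n) x)"
  obtains q where "set_pmf q \<subseteq> A" "converges_in_distribution p q sequentially"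
proof -
  \<comment> \<open>The value 0 off \<open>A\<close> keeps the total mass at 1 and the support
    inside \<open>A\<close>.\<close>
  define g where "g x = (if x \<in> A then lim (\<lambda>n. pmf (p n) x) else 0)" for x
  have g: "(\<lambda>n. pmf (p n) x) \<longlonglongrightarrow> g x" if "x \<in> A" for x
    using conv[OF that] that by (simp add: g_def convergent_LIMSEQ_iff)
  have nonneg: "0 \<le> g x" for x
    using g[of x] by (cases "x \<in> A") (auto simp: g_def intro: LIMSEQ_le_const)
  have "(\<lambda>n. \<Sum>x\<in>A. pmf (p n) x) \<longlonglongrightarrow> (\<Sum>x\<in>A. g x)"
    by (intro tendsto_sum g)
  then have one: "(\<Sum>x\<in>A. g x) = 1"
    using A by (simp add: sum_pmf_finite_support LIMSEQ_const_iff)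
  have "(\<integral>\<^sup>+ x. ennreal (g x) \<partial>count_space UNIV) = (\<Sum>x\<in>A. ennreal (g x))"
    by (rule nn_integral_count_space'[OF A(1)]) (auto simp: g_def)
  also have "\<dots> = 1"
    by (simp add: sum_ennreal nonneg one)
  finally have pmf_q: "pmf (embed_pmf g) x = g x" for x
    by (intro pmf_embed_pmf nonneg)
  have supp: "set_pmf (embed_pmf g) \<subseteq> A"
    by (auto simp: set_pmf_eq pmf_q g_def split: if_splits)
  have "(\<lambda>n. measure_pmf.expectation (p n) f) \<longlonglongrightarrow> measure_pmf.expectation (embed_pmf g) f"
    for f :: "'a \<Rightarrow> real"
  proof -
    have "(\<lambda>n. \<Sum>x\<in>A. pmf (p n) x * f x) \<longlonglongrightarrow> (\<Sum>x\<in>A. g x * f x)"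
      by (intro tendsto_sum tendsto_mult g tendsto_const)
    moreover have "measure_pmf.expectation (p n) f = (\<Sum>x\<in>A. pmf (p n) x * f x)" for n
      using A by (subst integral_measure_pmf[of A]) auto
    moreover have "measure_pmf.expectation (embed_pmf g) f = (\<Sum>x\<in>A. g x * f x)"
      using A supp by (subst integral_measure_pmf[of A]) (auto simp: pmf_q)
    ultimately show ?thesis by simp
  qed
  with supp show ?thesis
    by (intro that[of "embed_pmf g"]) (simp_all add: converges_in_distribution_def)
qed

section \<open>Comparison of expectations\<close>

lemma abs_expectation_diff_le:
  fixes f :: "'a \<Rightarrow> real"
  assumes A: "finite A" "set_pmf p \<subseteq> A" and f: "\<And>x. x \<in> A \<Longrightarrow> \<bar>f x - c\<bar> \<le> D"
  shows "\<bar>measure_pmf.expectation p f - c\<bar> \<le> D"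
proof -
  have "measure_pmf.expectation p f - c = (\<Sum>x\<in>A. pmf p x * (f x - c))"
    using A sum_pmf_finite_support[OF A]
    by (subst integral_measure_pmf[of A])
      (auto simp: right_diff_distrib sum_subtractf simp flip: sum_distrib_right)
  also have "\<bar>\<dots>\<bar> \<le> (\<Sum>x\<in>A. pmf p x * D)"
    by (intro order_trans[OF sum_abs] sum_mono) (simp add: abs_mult mult_left_mono f)
  also have "\<dots> = D"
    using sum_pmf_finite_support[OF A] by (simp flip: sum_distrib_right)
  finally show ?thesis .
qed

lemma expectation_atom_bound:
  fixes f :: "'a \<Rightarrow> real"
  assumes A: "finite A" "set_pmf p \<subseteq> A" and f: "\<And>z. z \<in> A \<Longrightarrow> 0 \<le> f z"
    and d: "x \<in> A" "d \<le> pmf p x"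
  shows "d * f x \<le> measure_pmf.expectation p f"
proof -
  have "d * f x \<le> pmf p x * f x"
    using f d by (intro mult_right_mono) auto
  also have "\<dots> \<le> (\<Sum>z\<in>A. pmf p z * f z)"
    using A d f by (intro member_le_sum) auto
  also have "\<dots> = measure_pmf.expectation p f"
    using A by (subst integral_measure_pmf[of A]) auto
  finally show ?thesis .
qed

text \<open>Let \<open>m\<close> be the minimum of \<open>f\<close> on \<open>A\<close>. The common
  atom \<open>x\<close> pulls one expectation below \<open>m + D\<close> by at least
  \<open>d * (m + D - f x)\<close> and lifts the other above \<open>m\<close> by at least
  \<open>d * (f x - m)\<close>. In the difference \<open>f x\<close> cancels and
  \<open>(1 - d) * D\<close> remains.\<close>

lemma doeblin_contraction:
  fixes f :: "'a \<Rightarrow> real"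
  assumes A: "finite A" "set_pmf p \<subseteq> A" "set_pmf q \<subseteq> A"
    and d: "x \<in> A" "d \<le> pmf p x" "d \<le> pmf q x"
    and f: "\<And>y z. y \<in> A \<Longrightarrow> z \<in> A \<Longrightarrow> \<bar>f y - f z\<bar> \<le> D"
  shows "\<bar>measure_pmf.expectation p f - measure_pmf.expectation q f\<bar> \<le> (1 - d) * D"
proof -
  have *: "measure_pmf.expectation r f - measure_pmf.expectation s f \<le> (1 - d) * D"
    if r: "set_pmf r \<subseteq> A" "d \<le> pmf r x" and s: "set_pmf s \<subseteq> A" "d \<le> pmf s x" for r s
  proof -
    define m where "m = Min (f ` A)"
    have "m \<in> f ` A"
      unfolding m_def using A(1) d(1) by (intro Min_in) auto
    then obtain y where y: "y \<in> A" "f y = m" by auto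
    have lo: "m \<le> f z" if "z \<in> A" for z
      unfolding m_def using A(1) that by simp
    have hi: "f z \<le> m + D" if "z \<in> A" for z
      using f[OF that y(1)] y(2) by linarith
    have int: "integrable (measure_pmf p) g" if "set_pmf p \<subseteq> A" for p and g :: "'a \<Rightarrow> real"
      using finite_subset[OF that A(1)] by (rule integrable_measure_pmf_finite)
    have "d * (m + D - f x) \<le> measure_pmf.expectation r (\<lambda>z. m + D - f z)"
      using A(1) r d(1) hi by (intro expectation_atom_bound[of A]) auto
    moreover have "d * (f x - m) \<le> measure_pmf.expectation s (\<lambda>z. f z - m)"
      using A(1) s d(1) lo by (intro expectation_atom_bound[of A]) auto
    ultimately show ?thesis
      using int r(1) s(1) by (simp add: algebra_simps)
  qed
  show ?thesis
    using *[of p q] *[of q p] A d by (simp add: abs_le_iff)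
qed

section \<open>One rectangle\<close>

lemma vertex_weight_nonzero_conserves:
  "vertex_weight t x y p q r s \<noteq> 0 \<Longrightarrow> (of_bool p + of_bool q :: int) = of_bool r + of_bool s"
  by (cases p; cases q; cases r; cases s) auto

lemma sum_telescope_atLeast1:
  fixes g :: "nat \<Rightarrow> int"
  shows "(\<Sum>k=1..n. g k - g (k - 1)) = g n - g 0"
  by (induction n) auto

text \<open>Summed over all vertices, the local balance telescopes vertically in each column and
  horizontally in each row, so that only boundary edges survive.\<close>

lemma num_arrows_outgoing:
  assumes "1 \<le> M" "1 \<le> N" "s \<in> boundary_states M N"
    and conserve: "\<And>v. v \<in> vertices M N \<Longrightarrow>
      (of_bool (bottom_arrow s c v) + of_bool (left_arrow s c v) :: int)
        = of_bool (v \<in> fst c) + of_bool (v \<in> snd c)"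
  shows "num_arrows (outgoing M N c) = num_arrows s"
proof -
  \<comment> \<open>Index 0 stands for the incoming boundary edges; an edge entering
    \<open>(i, j)\<close> is then always the edge with index \<open>j - 1\<close> or
    \<open>i - 1\<close>.\<close>
  let ?V = "\<lambda>i j. of_bool (if j = 0 then i \<in> fst s else (i, j) \<in> fst c) :: int"
  let ?H = "\<lambda>i j. of_bool (if i = 0 then j \<in> snd s else (i, j) \<in> snd c) :: int"
  have step: "?V i j - ?V i (j - 1) = ?H (i - 1) j - ?H i j"
    if "i \<in> {1..M}" "j \<in> {1..N}" for i j
  proof -
    have "?V i (j - 1) = of_bool (bottom_arrow s c (i, j))"
      "?H (i - 1) j = of_bool (left_arrow s c (i, j))"
      "?V i j = of_bool ((i, j) \<in> fst c)" "?H i j = of_bool ((i, j) \<in> snd c)"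
      using that by (auto simp: bottom_arrow_def left_arrow_def)
    then show ?thesis
      using conserve[of "(i, j)"] that unfolding vertices_def by simp
  qed
  have "(\<Sum>i=1..M. ?V i N - ?V i 0) = (\<Sum>i=1..M. \<Sum>j=1..N. ?V i j - ?V i (j - 1))"
    by (simp only: sum_telescope_atLeast1[of "?V i" for i])
  also have "\<dots> = (\<Sum>i=1..M. \<Sum>j=1..N. - (?H i j - ?H (i - 1) j))"
    by (intro sum.cong refl) (simp only: step minus_diff_eq)
  also have "\<dots> = (\<Sum>j=1..N. - (\<Sum>i=1..M. ?H i j - ?H (i - 1) j))"
    by (subst sum.swap) (simp only: sum_negf)
  also have "\<dots> = (\<Sum>j=1..N. ?H 0 j - ?H M j)"
    by (simp only: sum_telescope_atLeast1[of "\<lambda>i. ?H i j" for j] minus_diff_eq)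
  finally have eq: "(\<Sum>i=1..M. ?V i N) + (\<Sum>j=1..N. ?H M j)
      = (\<Sum>i=1..M. ?V i 0) + (\<Sum>j=1..N. ?H 0 j)"
    unfolding sum_subtractf by linarith
  have "{1..M} \<inter> fst s = fst s" "{1..N} \<inter> snd s = snd s"
    using assms(3) by (auto simp: boundary_states_def)
  moreover have "outgoing M N c = ({1..M} \<inter> {i. (i, N) \<in> fst c}, {1..N} \<inter> {j. (M, j) \<in> snd c})"
    by (auto simp: outgoing_def)
  ultimately have "int (num_arrows (outgoing M N c)) = int (num_arrows s)"
    using eq assms(1,2) by (simp add: num_arrows_def)
  then show ?thesis by simp
qed

section \<open>Filling all rows in one rectangle\<close>

text \<open>
  The configuration leading to \<open>s\<^sub>0\<close>: the \<open>m\<close>-th bottom arrow goes straight up to the \<open>m\<close>-th empty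
  row and turns right there. It never passes straight up a vertex without an arrow from the left,
  a move which is impossible for \<open>t = 0\<close>.
\<close>

definition filling_config :: "nat \<Rightarrow> nat \<Rightarrow> arrows \<Rightarrow> config" where
  "filling_config M N s =
     ({(i, j) \<in> vertices M N. i \<in> fst s \<and> card ({1..j} - snd s) < card (fst s \<inter> {1..i})},
      {(i, j) \<in> vertices M N. j \<in> snd s \<or> card ({1..j} - snd s) \<le> card (fst s \<inter> {1..i})})"

lemma card_Int_upto_Suc:
  "card (A \<inter> {1..Suc n}) = card (A \<inter> {1..n}) + of_bool (Suc n \<in> A)"
proof -
  have "A \<inter> {1..Suc n} = (if Suc n \<in> A then insert (Suc n) (A \<inter> {1..n}) else A \<inter> {1..n})"
    by (auto simp: le_Suc_eq)
  then show ?thesis by simp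
qed

lemma card_upto_Suc_Diff:
  "card ({1..Suc n} - B) = card ({1..n} - B) + of_bool (Suc n \<notin> B)"
  using card_Int_upto_Suc[of "- B" n] by (simp add: Diff_eq Int_commute)

text \<open>The two moves that are avoided have weights \<open>t * p\<close> and
  \<open>1 - p\<close> with \<open>p\<close> the value of \<open>right_prob\<close>. The first
  vanishes at \<open>t = 0\<close>, the second at column rapidity 0, so neither would allow a lower
  bound uniform in the scaling.\<close>

lemma weight_filling_config:
  fixes a b :: "nat \<Rightarrow> real"
  assumes "v \<in> vertices M N"
  shows "weight_at t a b s (filling_config M N s) v
    \<in> {1, right_prob t (a (fst v)) (b (snd v)), 1 - t * right_prob t (a (fst v)) (b (snd v))}"
proof -
  obtain i j where v: "v = (Suc i, Suc j)" and ij: "Suc i \<le> M" "Suc j \<le> N"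
    using assms unfolding vertices_def
    by (metis SigmaE atLeastAtMost_iff not0_implies_Suc not_one_le_zero)
  define \<alpha> \<beta> where "\<alpha> = (\<lambda>i. card (fst s \<inter> {1..i}))" and "\<beta> = (\<lambda>j. card ({1..j} - snd s))"
  have \<alpha>: "\<alpha> (Suc i) = \<alpha> i + of_bool (Suc i \<in> fst s)" "\<alpha> 0 = 0"
    unfolding \<alpha>_def by (rule card_Int_upto_Suc) simp
  have \<beta>: "\<beta> (Suc j) = \<beta> j + of_bool (Suc j \<notin> snd s)" "\<beta> 0 = 0"
    unfolding \<beta>_def by (rule card_upto_Suc_Diff) simp
  let ?c = "filling_config M N s"
  have top: "v \<in> fst ?c \<longleftrightarrow> Suc i \<in> fst s \<and> \<beta> (Suc j) < \<alpha> (Suc i)"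
    using ij by (auto simp: filling_config_def v vertices_def \<alpha>_def \<beta>_def)
  have right: "v \<in> snd ?c \<longleftrightarrow> Suc j \<in> snd s \<or> \<beta> (Suc j) \<le> \<alpha> (Suc i)"
    using ij by (auto simp: filling_config_def v vertices_def \<alpha>_def \<beta>_def)
  \<comment> \<open>The interior formula also fits the boundary: in the bottom row
    \<open>\<beta> 0 = 0\<close>, while a column with an arrow has already counted it in
    \<open>\<alpha> (Suc i)\<close>. For \<open>left\<close> below, \<open>\<alpha> 0 = 0\<close>
    excludes the empty rows.\<close>
  have bottom: "bottom_arrow s ?c v \<longleftrightarrow> Suc i \<in> fst s \<and> \<beta> j < \<alpha> (Suc i)"
  proof (cases "j = 0")
    case True
    then show ?thesis using \<alpha> \<beta> by (auto simp: bottom_arrow_def v)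
  next
    case False
    then show ?thesis
      using ij by (auto simp: bottom_arrow_def filling_config_def v vertices_def \<alpha>_def \<beta>_def)
  qed
  have left: "left_arrow s ?c v \<longleftrightarrow> Suc j \<in> snd s \<or> \<beta> (Suc j) \<le> \<alpha> i"
  proof (cases "i = 0")
    case True
    then show ?thesis using \<alpha> \<beta> by (auto simp: left_arrow_def v)
  next
    case False
    then show ?thesis
      using ij by (auto simp: left_arrow_def filling_config_def v vertices_def \<alpha>_def \<beta>_def)
  qed
  \<comment> \<open>The order of \<open>\<alpha> i\<close> and \<open>\<beta> j\<close> settles all
    four edges; an arrow turns right exactly when column \<open>Suc i\<close> has a bottom arrow,
    row \<open>Suc j\<close> is empty and \<open>\<alpha> i = \<beta> j\<close>.\<close>
  show ?thesis
    unfolding weight_at_def top right bottom left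
    by (cases "Suc i \<in> fst s"; cases "Suc j \<in> snd s";
        cases "\<alpha> i" "\<beta> j" rule: linorder_cases) (simp_all add: \<alpha> \<beta>)
qed

text \<open>Having \<open>N\<close> arrows in total means as many empty rows as bottom arrows. So
  every bottom arrow has turned by the top row, and every row is occupied after the last
  column.\<close>

lemma outgoing_filling_config:
  assumes "1 \<le> M" "1 \<le> N" "s \<in> boundary_states M N" "num_arrows s = N"
  shows "outgoing M N (filling_config M N s) = ({}, {1..N})"
proof -
  have s: "fst s \<subseteq> {1..M}" "snd s \<subseteq> {1..N}"
    using assms(3) by (auto simp: boundary_states_def)
  have empty_rows: "card ({1..N} - snd s) = card (fst s)"
    using assms(4) s card_Diff_subset[OF finite_subset[OF s(2)] s(2)]
    by (simp add: num_arrows_def)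
  have "card (fst s \<inter> {1..i}) \<le> card ({1..N} - snd s)" for i
    unfolding empty_rows using finite_subset[OF s(1)] by (intro card_mono) auto
  moreover have "card ({1..j} - snd s) \<le> card (fst s \<inter> {1..M})" if "j \<le> N" for j
    using that s(1) unfolding Int_absorb2[OF s(1)] empty_rows[symmetric]
    by (intro card_mono) auto
  ultimately show ?thesis
    using assms(1,2) by (auto simp: outgoing_def filling_config_def vertices_def not_less)
qed

definition sector :: "nat \<Rightarrow> nat \<Rightarrow> arrows set" where
  "sector M N = {s \<in> boundary_states M N. num_arrows s = N}"

lemma finite_boundary_states: "finite (boundary_states M N)"
  by (simp add: boundary_states_def)

lemma finite_sector: "finite (sector M N)"
  by (simp add: sector_def finite_boundary_states)

lemma full_rows_in_sector: "({}, {1..N}) \<in> sector M N"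
  by (simp add: sector_def boundary_states_def num_arrows_def)

lemma finite_configs: "finite (configs M N)"
  by (simp add: configs_def vertices_def)

section \<open>Rectangles with scaled column rapidities\<close>

locale rapidities =
  fixes M N :: nat and t :: real and a b :: "nat \<Rightarrow> real"
  assumes M: "1 \<le> M" and N: "1 \<le> N" and t: "0 \<le> t" "t < 1"
    and a: "\<And>i. i \<in> {1..M} \<Longrightarrow> 0 < a i \<and> a i < 1"
    and b: "\<And>j. j \<in> {1..N} \<Longrightarrow> 0 < b j \<and> b j < 1"
begin

abbreviation scaled :: "real \<Rightarrow> arrows \<Rightarrow> arrows pmf" where
  "scaled v \<equiv> six_vertex M N t (\<lambda>i. v * a i) b"

abbreviation chain :: "real \<Rightarrow> nat \<Rightarrow> arrows \<Rightarrow> arrows pmf" where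
  "chain u \<equiv> quasi_periodic_from M N t a b u"

lemma rapidity_product_bounds: "i \<in> {1..M} \<Longrightarrow> j \<in> {1..N} \<Longrightarrow> 0 < a i * b j \<and> a i * b j < 1"
  using a[of i] b[of j] mult_strict_mono[of "a i" 1 "b j" 1] by simp

lemma scaled_rapidity_product_bounds:
  assumes "v \<in> {0..1}" "i \<in> {1..M}" "j \<in> {1..N}"
  shows "0 \<le> v * a i * b j" "v * a i * b j \<le> a i * b j" "v * a i * b j < 1"
proof -
  have "v * (a i * b j) \<le> 1 * (a i * b j)"
    using assms rapidity_product_bounds[of i j] by (intro mult_right_mono) auto
  then show "0 \<le> v * a i * b j" "v * a i * b j \<le> a i * b j" "v * a i * b j < 1"
    using assms rapidity_product_bounds[of i j] by (auto simp: mult.assoc)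
qed

lemma pmf_config_scaled:
  assumes "v \<in> {0..1}"
  shows "pmf (config_pmf M N t (\<lambda>i. v * a i) b s) c = config_prob M N t (\<lambda>i. v * a i) b s c"
  using t scaled_rapidity_product_bounds[OF assms] by (intro pmf_config_pmf) auto

lemma set_config_scaled:
  assumes "v \<in> {0..1}"
  shows "set_pmf (config_pmf M N t (\<lambda>i. v * a i) b s) \<subseteq> configs M N"
  by (auto simp: set_pmf_eq pmf_config_scaled[OF assms] config_prob_def split: if_splits)

lemma set_scaled_subset_boundary_states: "set_pmf (scaled v s) \<subseteq> boundary_states M N"
  by (auto simp: six_vertex_def outgoing_def boundary_states_def)

lemma finite_set_scaled: "finite (set_pmf (scaled v s))"
  by (rule finite_subset[OF set_scaled_subset_boundary_states finite_boundary_states])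

lemma set_scaled_subset_sector:
  assumes "v \<in> {0..1}" "s \<in> sector M N"
  shows "set_pmf (scaled v s) \<subseteq> sector M N"
proof
  fix s' assume s': "s' \<in> set_pmf (scaled v s)"
  then obtain c where c: "s' = outgoing M N c"
    "c \<in> set_pmf (config_pmf M N t (\<lambda>i. v * a i) b s)"
    by (auto simp: six_vertex_def)
  then have "config_prob M N t (\<lambda>i. v * a i) b s c \<noteq> 0"
    by (simp add: set_pmf_eq pmf_config_scaled[OF assms(1)])
  then have "weight_at t (\<lambda>i. v * a i) b s c w \<noteq> 0" if "w \<in> vertices M N" for w
    using that by (auto simp: config_prob_def vertices_def split: if_splits)
  then have "num_arrows s' = num_arrows s"
    unfolding c(1) using assms(2)
    by (intro num_arrows_outgoing M N)
      (auto simp only: sector_def mem_Collect_eq weight_at_def dest!: vertex_weight_nonzero_conserves)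
  then show "s' \<in> sector M N"
    using assms(2) s' set_scaled_subset_boundary_states[of v s] by (auto simp: sector_def)
qed

text \<open>Each factor lies below all three weights that occur in \<open>filling_config\<close>,
  for every scaling \<open>v\<close> in [0,1]: with \<open>p\<close> the scaled
  \<open>right_prob\<close>, \<open>1 - t\<close> is at most \<open>1 - t * p\<close>, and
  \<open>1 - a i * b j\<close> is at most \<open>p\<close>.\<close>

definition floor_prob :: real where
  "floor_prob = (\<Prod>v\<in>vertices M N. (1 - t) * (1 - a (fst v) * b (snd v)))"

lemma floor_prob_pos: "0 < floor_prob"
  unfolding floor_prob_def using t rapidity_product_bounds by (intro prod_pos) (auto simp: vertices_def)

lemma floor_prob_le_pmf_scaled:
  assumes v: "v \<in> {0..1}" and s: "s \<in> sector M N"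
  shows "floor_prob \<le> pmf (scaled v s) ({}, {1..N})"
proof -
  let ?c = "filling_config M N s"
  have weight: "(1 - t) * (1 - a (fst w) * b (snd w)) \<le> weight_at t (\<lambda>i. v * a i) b s ?c w"
    if w: "w \<in> vertices M N" for w
  proof -
    obtain i j where ij: "w = (i, j)" "i \<in> {1..M}" "j \<in> {1..N}"
      using w by (auto simp: vertices_def)
    define x where "x = v * a i * b j"
    define p where "p = right_prob t (v * a i) (b j)"
    have x: "0 \<le> x" "x \<le> a i * b j" "x < 1"
      using scaled_rapidity_product_bounds[OF v ij(2,3)] by (auto simp: x_def)
    have "p \<le> 1"
      using right_prob_bounds[OF t, of "v * a i" "b j"] x unfolding p_def x_def by simp
    then have "t * p \<le> t * 1"
      using t by (intro mult_left_mono) auto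
    have tx: "0 \<le> t * x" "t * x < 1"
      using t x mult_le_one[of t x] mult_strict_mono[of t 1 x 1] by auto
    \<comment> \<open>The denominator \<open>1 - t * x\<close> lies in (0,1], so division by it
      cannot decrease \<open>1 - x\<close>.\<close>
    have "1 - x \<le> p"
      using tx x by (simp add: p_def right_prob_def x_def[symmetric] mult.assoc[symmetric]
        le_divide_eq mult_le_cancel_left1) (simp add: x_def mult.assoc)
    moreover have "(1 - t) * (1 - a i * b j) \<le> 1 - a i * b j"
      using t rapidity_product_bounds[OF ij(2,3)] by (simp add: mult_le_cancel_right1)
    ultimately have "(1 - t) * (1 - a i * b j) \<le> p"
      using x(2) by linarith
    moreover have "(1 - t) * (1 - a i * b j) \<le> 1 - t"
      using t rapidity_product_bounds[OF ij(2,3)] by (simp add: mult_le_cancel_left2)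
    then have "(1 - t) * (1 - a i * b j) \<le> 1 - t * p"
      by (rule order_trans) (use \<open>t * p \<le> t * 1\<close> in simp)
    moreover have "(1 - t) * (1 - a i * b j) \<le> 1"
      using t rapidity_product_bounds[OF ij(2,3)] by (intro mult_le_one) auto
    moreover have "weight_at t (\<lambda>i. v * a i) b s ?c w \<in> {1, p, 1 - t * p}"
      using weight_filling_config[OF w, of t "\<lambda>i. v * a i" b s] by (simp add: ij p_def)
    ultimately show ?thesis
      by (elim insertE emptyE) (simp_all only: ij fst_conv snd_conv)
  qed
  have "floor_prob \<le> (\<Prod>w\<in>vertices M N. weight_at t (\<lambda>i. v * a i) b s ?c w)"
    unfolding floor_prob_def using t rapidity_product_bounds weight
    by (intro prod_mono) (auto simp: vertices_def less_imp_le)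
  also have "\<dots> = pmf (config_pmf M N t (\<lambda>i. v * a i) b s) ?c"
    by (auto simp: pmf_config_scaled[OF v] config_prob_def configs_def filling_config_def)
  also have "\<dots> = measure_pmf.prob (config_pmf M N t (\<lambda>i. v * a i) b s) {?c}"
    by (simp add: measure_pmf_single)
  also have "\<dots> \<le> pmf (scaled v s) ({}, {1..N})"
    unfolding six_vertex_def pmf_map using s outgoing_filling_config[OF M N]
    by (intro measure_pmf.finite_measure_mono) (auto simp: sector_def)
  finally show ?thesis .
qed

text \<open>Being a lower bound for a probability suffices. With \<open>floor_prob_pos\<close> this
  puts the contraction ratio \<open>1 - floor_prob\<close> in [0,1).\<close>

lemma floor_prob_le_1: "floor_prob \<le> 1"
  using floor_prob_le_pmf_scaled[of 1 "({}, {1..N})"] full_rows_in_sector pmf_le_1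
  by (meson atLeastAtMost_iff order_refl order_trans zero_le_one)

text \<open>The expectation is a finite sum of products of weights that are rational in
  \<open>u\<close>, with denominators nonzero on [0,1]. The integrand may depend on \<open>u\<close>
  because in the induction over the chain it is the expectation for the remaining
  rectangles.\<close>

lemma continuous_on_expectation_scaled:
  fixes f :: "real \<Rightarrow> arrows \<Rightarrow> real"
  assumes "\<And>z. continuous_on {0..1} (\<lambda>u. f u z)"
  shows "continuous_on {0..1} (\<lambda>u. measure_pmf.expectation (scaled (u ^ l) s) (f u))"
proof -
  have weight: "continuous_on {0..1} (\<lambda>u. weight_at t (\<lambda>i. u ^ l * a i) b s c w)"
    if w: "w \<in> vertices M N" for c w
  proof -
    obtain i j where ij: "w = (i, j)" "i \<in> {1..M}" "j \<in> {1..N}"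
      using w by (auto simp: vertices_def)
    have "t * (u ^ l * a i) * b j \<noteq> 1" if "u \<in> {0..1}" for u
    proof -
      have "u ^ l \<in> {0..1}" using that by (simp add: power_le_one)
      from scaled_rapidity_product_bounds[OF this ij(2,3)] t show ?thesis
        using mult_strict_mono[of t 1 "u ^ l * a i * b j" 1] by (simp add: mult.assoc)
    qed
    then have p: "continuous_on {0..1} (\<lambda>u. right_prob t (u ^ l * a i) (b j))"
      unfolding right_prob_def by (intro continuous_intros) auto
    show ?thesis
      unfolding weight_at_def ij fst_conv snd_conv
      by (cases "bottom_arrow s c (i, j)"; cases "left_arrow s c (i, j)";
          cases "(i, j) \<in> fst c"; cases "(i, j) \<in> snd c")
        (auto intro!: continuous_intros p)
  qed
  have "continuous_on {0..1} (\<lambda>u. config_prob M N t (\<lambda>i. u ^ l * a i) b s c)" for c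
    unfolding config_prob_def
    by (cases "c \<in> configs M N") (simp_all add: weight continuous_on_prod)
  then have sum: "continuous_on {0..1} (\<lambda>u. \<Sum>c\<in>configs M N.
      config_prob M N t (\<lambda>i. u ^ l * a i) b s c * f u (outgoing M N c))"
    by (intro continuous_intros assms)
  \<comment> \<open>\<open>config_prob\<close> is known to give the actual probabilities only for
    scalings in [0,1], so the identification is made pointwise on that interval.\<close>
  have "(\<Sum>c\<in>configs M N. config_prob M N t (\<lambda>i. u ^ l * a i) b s c * f u (outgoing M N c)) =
      measure_pmf.expectation (scaled (u ^ l) s) (f u)"
    if "u \<in> {0..1}" for u
  proof -
    have u: "u ^ l \<in> {0..1}" using that by (simp add: power_le_one)
    show ?thesis
      unfolding six_vertex_def integral_map_pmf using set_config_scaled[OF u, of s]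
      by (subst integral_measure_pmf[OF finite_configs]) (auto simp: pmf_config_scaled[OF u])
  qed
  with sum show ?thesis by (rule continuous_on_eq)
qed

section \<open>The chain of rectangles\<close>

lemma set_chain_subset_sector:
  assumes "u \<in> {0..1}" "s \<in> sector M N"
  shows "set_pmf (chain u l s) \<subseteq> sector M N"
  using assms(2)
proof (induction l arbitrary: s)
  case (Suc l)
  have "u ^ l \<in> {0..1}" using assms(1) by (simp add: power_le_one)
  from set_scaled_subset_sector[OF this Suc.prems] Suc.IH show ?case by auto
qed simp

lemma finite_set_chain: "finite (set_pmf (chain u l s))"
  by (induction l arbitrary: s) (auto simp: finite_set_scaled)

lemma expectation_chain_Suc:
  fixes f :: "arrows \<Rightarrow> real"
  shows "measure_pmf.expectation (chain u (Suc l) s) f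
    = measure_pmf.expectation (scaled (u ^ l) s) (\<lambda>z. measure_pmf.expectation (chain u l z) f)"
  by (simp add: expectation_bind_finite[OF finite_set_scaled order_refl finite_set_chain])

lemma continuous_on_expectation_chain:
  fixes f :: "arrows \<Rightarrow> real"
  shows "continuous_on {0..1} (\<lambda>u. measure_pmf.expectation (chain u l s) f)"
proof (induction l arbitrary: s)
  case (Suc l)
  then show ?case
    unfolding expectation_chain_Suc by (rule continuous_on_expectation_scaled)
qed simp

text \<open>Induction peels off the rectangle at the input: by hypothesis the expectation over the
  remaining ones oscillates by at most \<open>(1 - floor_prob) ^ l * D\<close> on the sector, and
  the common atom at the full-row state gains one more factor.\<close>

lemma expectation_chain_contraction:
  fixes f :: "arrows \<Rightarrow> real"
  assumes u: "u \<in> {0..1}" and f: "\<And>y z. \<bar>f y - f z\<bar> \<le> D"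
    and "s \<in> sector M N" "s' \<in> sector M N"
  shows "\<bar>measure_pmf.expectation (chain u l s) f - measure_pmf.expectation (chain u l s') f\<bar>
    \<le> (1 - floor_prob) ^ l * D"
  using assms(3,4)
proof (induction l arbitrary: s s')
  case (Suc l)
  have "u ^ l \<in> {0..1}" using u by (simp add: power_le_one)
  then show ?case
    unfolding expectation_chain_Suc power_Suc mult.assoc
    using Suc.prems
    by (intro doeblin_contraction[OF finite_sector[of M N], where x = "({}, {1..N})"]
        set_scaled_subset_sector floor_prob_le_pmf_scaled full_rows_in_sector Suc.IH)
qed (simp add: f)

lemma bounded_range_oscillation:
  fixes f :: "arrows \<Rightarrow> real"
  assumes "bounded (range f)"
  obtains D where "0 \<le> D" "\<And>y z. \<bar>f y - f z\<bar> \<le> D"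
proof -
  obtain B where B: "\<And>y. \<bar>f y\<bar> \<le> B"
    using assms by (auto simp: bounded_iff)
  have "\<bar>f y - f z\<bar> \<le> 2 * B" for y z
    using B[of y] B[of z] by linarith
  moreover have "0 \<le> 2 * B" using B[of undefined] by linarith
  ultimately show ?thesis using that by blast
qed

section \<open>Limit of long chains, uniformly in u\<close>

abbreviation start :: arrows where "start \<equiv> ({}, {1..N})"

text \<open>Rectangles are numbered from the output, so the last \<open>l\<close> of them traversed
  are the same in both chains. The longer chain is the shorter one with a random input from the
  sector, and the input is forgotten at the contraction rate.\<close>

lemma expectation_chain_cauchy:
  fixes f :: "arrows \<Rightarrow> real"
  assumes u: "u \<in> {0..1}" and f: "\<And>y z. \<bar>f y - f z\<bar> \<le> D" and "l \<le> n"
  shows "\<bar>measure_pmf.expectation (chain u n start) f - measure_pmf.expectation (chain u l start) f\<bar>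
    \<le> (1 - floor_prob) ^ l * D"
proof -
  have "\<exists>p. set_pmf p \<subseteq> sector M N \<and> chain u (l + k) start = bind_pmf p (chain u l)" for k
  proof -
    \<comment> \<open>All inputs are needed in the induction, since the recursion runs the rectangle
      at the input first and passes on an arbitrary state of the sector.\<close>
    have "\<forall>s \<in> sector M N. \<exists>p. set_pmf p \<subseteq> sector M N \<and> chain u (l + k) s = bind_pmf p (chain u l)"
    proof (induction k)
      case 0
      show ?case by (auto simp: bind_return_pmf intro!: exI[of _ "return_pmf _"])
    next
      case (Suc k)
      then obtain P where P: "\<And>s. s \<in> sector M N \<Longrightarrow> set_pmf (P s) \<subseteq> sector M N"
        "\<And>s. s \<in> sector M N \<Longrightarrow> chain u (l + k) s = bind_pmf (P s) (chain u l)"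
        by metis
      show ?case
      proof
        fix s assume s: "s \<in> sector M N"
        have "u ^ (l + k) \<in> {0..1}" using u by (simp add: power_le_one)
        note set = set_scaled_subset_sector[OF this s]
        have "chain u (l + Suc k) s = bind_pmf (scaled (u ^ (l + k)) s) (\<lambda>x. bind_pmf (P x) (chain u l))"
          using set P(2) by (auto intro!: bind_pmf_cong)
        then have "chain u (l + Suc k) s = bind_pmf (bind_pmf (scaled (u ^ (l + k)) s) P) (chain u l)"
          by (simp only: bind_assoc_pmf)
        moreover have "set_pmf (bind_pmf (scaled (u ^ (l + k)) s) P) \<subseteq> sector M N"
          using set P(1) by auto
        ultimately show "\<exists>p. set_pmf p \<subseteq> sector M N \<and> chain u (l + Suc k) s = bind_pmf p (chain u l)"
          by blast
      qed
    qed
    then show ?thesis using full_rows_in_sector by blast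
  qed
  from this[of "n - l"] \<open>l \<le> n\<close> obtain p where p: "set_pmf p \<subseteq> sector M N"
    "chain u n start = bind_pmf p (chain u l)" by auto
  show ?thesis
    unfolding p(2) expectation_bind_finite[OF finite_sector p(1) finite_set_chain]
    by (intro abs_expectation_diff_le[OF finite_sector p(1)]
        expectation_chain_contraction u f full_rows_in_sector)
qed

lemma chain_error_tendsto_0: "(\<lambda>l. (1 - floor_prob) ^ l * D) \<longlonglongrightarrow> 0"
  using floor_prob_pos floor_prob_le_1 by (intro tendsto_mult_left_zero LIMSEQ_power_zero) auto

text \<open>The Cauchy bound does not contain \<open>u\<close>. Here \<open>lim\<close> names the
  limit before it is identified as an expectation under a distribution.\<close>

lemma uniform_limit_expectation_chain:
  fixes f :: "arrows \<Rightarrow> real"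
  assumes "bounded (range f)"
  shows "uniform_limit {0..1} (\<lambda>L u. measure_pmf.expectation (chain u L start) f)
    (\<lambda>u. lim (\<lambda>L. measure_pmf.expectation (chain u L start) f)) sequentially"
proof -
  obtain D where D: "0 \<le> D" "\<And>y z. \<bar>f y - f z\<bar> \<le> D"
    using bounded_range_oscillation[OF assms] by blast
  have "uniformly_Cauchy_on {0..1} (\<lambda>L u. measure_pmf.expectation (chain u L start) f)"
  proof (rule uniformly_Cauchy_onI')
    fix e :: real assume "0 < e"
    then obtain L where L: "\<And>l. L \<le> l \<Longrightarrow> (1 - floor_prob) ^ l * D < e"
      using order_tendstoD(2)[OF chain_error_tendsto_0[of D]] by (auto simp: eventually_sequentially)
    have "dist (measure_pmf.expectation (chain u l start) f)
        (measure_pmf.expectation (chain u n start) f) < e"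
      if "u \<in> {0..1}" "L \<le> l" "l < n" for u l n
      using expectation_chain_cauchy[where f = f, OF that(1) D(2), of l n] L[OF that(2)] that(3)
      by (simp add: dist_real_def abs_minus_commute)
    then show "\<exists>L. \<forall>u\<in>{0..1}. \<forall>l\<ge>L. \<forall>n>l. dist (measure_pmf.expectation (chain u l start) f)
        (measure_pmf.expectation (chain u n start) f) < e"
      by blast
  qed
  then show ?thesis
    using Cauchy_uniformly_convergent uniformly_convergent_uniform_limit_iff by blast
qed

text \<open>This justifies the \<open>THE\<close> in \<open>quasi_periodic\<close>: singleton
  indicators as test functions give convergence of every probability, and limits in distribution are
  unique. The endpoint \<open>u = 1\<close> is included so that the periodic model can be reached by
  continuity.\<close>

lemma quasi_periodic_converges:
  assumes u: "u \<in> {0..1}"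
  shows "converges_in_distribution (quasi_periodic_length M N t a b u)
      (quasi_periodic M N t a b u) sequentially"
    and "set_pmf (quasi_periodic M N t a b u) \<subseteq> sector M N"
proof -
  have "convergent (\<lambda>L. pmf (chain u L start) x)" for x
  proof -
    have "bounded (range (indicator {x} :: arrows \<Rightarrow> real))"
      by (auto simp: bounded_iff indicator_def intro!: exI[of _ 1])
    from tendsto_uniform_limitI[OF uniform_limit_expectation_chain[OF this] u]
    show ?thesis unfolding expectation_indicator_singleton by (auto simp: convergent_def)
  qed
  then obtain q where q: "set_pmf q \<subseteq> sector M N"
    "converges_in_distribution (\<lambda>L. chain u L start) q sequentially"
    using converges_in_distribution_finite_support[OF finite_sector[of M N],
        of "\<lambda>L. chain u L start"] set_chain_subset_sector[OF u full_rows_in_sector] by metis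
  have len: "quasi_periodic_length M N t a b u = (\<lambda>L. chain u L start)"
    by (simp add: quasi_periodic_length_def fun_eq_iff)
  have "quasi_periodic M N t a b u = q"
    unfolding quasi_periodic_def len
    using q(2) by (intro the_equality) (auto dest: converges_in_distribution_unique)
  with q show "converges_in_distribution (quasi_periodic_length M N t a b u)
      (quasi_periodic M N t a b u) sequentially"
    and "set_pmf (quasi_periodic M N t a b u) \<subseteq> sector M N"
    by (simp_all add: len)
qed

lemma expectation_chain_tendsto:
  fixes f :: "arrows \<Rightarrow> real"
  assumes "u \<in> {0..1}" "bounded (range f)"
  shows "(\<lambda>L. measure_pmf.expectation (chain u L start) f)
    \<longlonglongrightarrow> measure_pmf.expectation (quasi_periodic M N t a b u) f"
  using quasi_periodic_converges(1)[OF assms(1)] assms(2)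
  by (simp add: converges_in_distribution_def quasi_periodic_length_def)

lemma continuous_on_expectation_quasi_periodic:
  fixes f :: "arrows \<Rightarrow> real"
  assumes "bounded (range f)"
  shows "continuous_on {0..1} (\<lambda>u. measure_pmf.expectation (quasi_periodic M N t a b u) f)"
proof -
  have lim: "continuous_on {0..1} (\<lambda>u. lim (\<lambda>L. measure_pmf.expectation (chain u L start) f))"
    using continuous_on_expectation_chain
    by (intro uniform_limit_theorem[OF _ uniform_limit_expectation_chain[OF assms]]) auto
  have "lim (\<lambda>L. measure_pmf.expectation (chain u L start) f)
      = measure_pmf.expectation (quasi_periodic M N t a b u) f" if "u \<in> {0..1}" for u
    using limI[OF expectation_chain_tendsto[OF that assms]] .
  with lim show ?thesis by (rule continuous_on_eq)
qed

section \<open>The periodic model\<close>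

text \<open>At \<open>u = 1\<close> all rectangles have the same law, so one may be peeled off at
  the output instead of the input, turning the chain into powers of the periodic kernel.\<close>

lemma chain_1_Suc: "chain 1 (Suc l) = (\<lambda>s. bind_pmf (chain 1 l s) (six_vertex M N t a b))"
proof (induction l)
  case 0
  have "chain 1 0 = return_pmf" by (simp add: fun_eq_iff)
  then show ?case by (intro ext) (simp add: bind_return_pmf bind_return_pmf')
next
  case (Suc l)
  have "chain 1 (Suc (Suc l)) s = bind_pmf (chain 1 (Suc l) s) (six_vertex M N t a b)" for s
  proof -
    have "chain 1 (Suc (Suc l)) s = bind_pmf (six_vertex M N t a b s) (chain 1 (Suc l))"
      by simp
    also have "\<dots> = bind_pmf (bind_pmf (six_vertex M N t a b s) (chain 1 l)) (six_vertex M N t a b)"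
      by (simp only: Suc bind_assoc_pmf)
    finally show ?thesis by simp
  qed
  then show ?case by blast
qed

text \<open>One more periodic step turns length \<open>L\<close> into \<open>Suc L\<close>, and both
  lengths have the same limit. The step acts on test functions by averaging against the kernel,
  which preserves boundedness.\<close>

lemma quasi_periodic_1_stationary: "is_periodic_stationary M N t a b N (quasi_periodic M N t a b 1)"
proof -
  let ?q = "quasi_periodic M N t a b 1" and ?K = "six_vertex M N t a b"
  have K: "finite (set_pmf (?K s))" for s
    using finite_set_scaled[of 1 s] by simp
  have q: "set_pmf ?q \<subseteq> sector M N"
    by (rule quasi_periodic_converges(2)) simp
  have "bind_pmf ?q ?K = ?q"
  proof (rule pmf_eq_if_expectation_eq)
    fix f :: "arrows \<Rightarrow> real" assume f: "bounded (range f)"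
    then obtain B where B: "\<And>y. \<bar>f y\<bar> \<le> B" by (auto simp: bounded_iff)
    have "bounded (range (\<lambda>s. measure_pmf.expectation (?K s) f))"
      using abs_expectation_diff_le[OF K order_refl, of _ f 0 B] B
      by (auto simp: bounded_iff)
    then have "(\<lambda>L. measure_pmf.expectation (chain 1 L start) (\<lambda>s. measure_pmf.expectation (?K s) f))
        \<longlonglongrightarrow> measure_pmf.expectation ?q (\<lambda>s. measure_pmf.expectation (?K s) f)"
      by (intro expectation_chain_tendsto) auto
    then have "(\<lambda>L. measure_pmf.expectation (chain 1 (Suc L) start) f)
        \<longlonglongrightarrow> measure_pmf.expectation (bind_pmf ?q ?K) f"
      unfolding chain_1_Suc expectation_bind_finite[OF finite_set_chain order_refl K]
        expectation_bind_finite[OF finite_sector q K] .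
    moreover have "(\<lambda>L. measure_pmf.expectation (chain 1 (Suc L) start) f)
        \<longlonglongrightarrow> measure_pmf.expectation ?q f"
      using f by (intro LIMSEQ_Suc expectation_chain_tendsto) auto
    ultimately show "measure_pmf.expectation (bind_pmf ?q ?K) f = measure_pmf.expectation ?q f"
      by (rule LIMSEQ_unique)
  qed
  with q show ?thesis by (simp add: is_periodic_stationary_def sector_def)
qed

text \<open>A stationary law on the sector is unchanged by a chain of any length, while the chain
  forgets its input; its expectations therefore agree with the limits from
  \<open>start\<close>.\<close>

lemma periodic_stationary_unique:
  assumes "is_periodic_stationary M N t a b N q"
  shows "q = quasi_periodic M N t a b 1"
proof (rule pmf_eq_if_expectation_eq)
  fix f :: "arrows \<Rightarrow> real" assume f: "bounded (range f)"
  obtain D where D: "0 \<le> D" "\<And>y z. \<bar>f y - f z\<bar> \<le> D"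
    using bounded_range_oscillation[OF f] by blast
  have q: "set_pmf q \<subseteq> sector M N" "bind_pmf q (six_vertex M N t a b) = q"
    using assms by (auto simp: is_periodic_stationary_def sector_def)
  have inv: "bind_pmf q (chain 1 l) = q" for l
  proof (induction l)
    case (Suc l)
    have "bind_pmf q (chain 1 (Suc l)) = bind_pmf (bind_pmf q (chain 1 l)) (six_vertex M N t a b)"
      by (simp only: chain_1_Suc bind_assoc_pmf)
    then show ?case by (simp only: Suc q(2))
  qed (simp add: bind_return_pmf')
  have "\<bar>measure_pmf.expectation q f - measure_pmf.expectation (chain 1 l start) f\<bar>
      \<le> (1 - floor_prob) ^ l * D" for l
  proof -
    have "\<bar>measure_pmf.expectation (bind_pmf q (chain 1 l)) f
        - measure_pmf.expectation (chain 1 l start) f\<bar> \<le> (1 - floor_prob) ^ l * D"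
      unfolding expectation_bind_finite[OF finite_sector q(1) finite_set_chain]
      by (intro abs_expectation_diff_le[OF finite_sector q(1)] expectation_chain_contraction
          D full_rows_in_sector) auto
    then show ?thesis by (simp only: inv)
  qed
  then have "(\<lambda>l. measure_pmf.expectation q f - measure_pmf.expectation (chain 1 l start) f) \<longlonglongrightarrow> 0"
    by (intro Lim_null_comparison[OF _ chain_error_tendsto_0[of D]]) simp
  moreover have "(\<lambda>l. measure_pmf.expectation q f - measure_pmf.expectation (chain 1 l start) f)
      \<longlonglongrightarrow> measure_pmf.expectation q f - measure_pmf.expectation (quasi_periodic M N t a b 1) f"
    using f by (intro tendsto_intros expectation_chain_tendsto) auto
  ultimately show "measure_pmf.expectation q f
      = measure_pmf.expectation (quasi_periodic M N t a b 1) f"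
    using LIMSEQ_unique by fastforce
qed

lemma periodic_stationary_eq: "periodic_stationary M N t a b N = quasi_periodic M N t a b 1"
  unfolding periodic_stationary_def
  using quasi_periodic_1_stationary periodic_stationary_unique by (rule the_equality)

end

theorem proposition5p9:
  fixes M N :: nat and t :: real and a b :: "nat \<Rightarrow> real"
  assumes "1 \<le> M" and "1 \<le> N"
    and "0 \<le> t" and "t < 1"
    and "\<And>i. i \<in> {1..M} \<Longrightarrow> 0 < a i \<and> a i < 1"
    and "\<And>j. j \<in> {1..N} \<Longrightarrow> 0 < b j \<and> b j < 1"
  shows "converges_in_distribution (\<lambda>u. quasi_periodic M N t a b u)
           (periodic_stationary M N t a b N) (at_left (1::real))"
proof -
  interpret rapidities M N t a b
    using assms by unfold_locales
  show ?thesis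
    unfolding converges_in_distribution_def periodic_stationary_eq
  proof (intro allI impI)
    fix f :: "arrows \<Rightarrow> real" assume "bounded (range f)"
    \<comment> \<open>Continuity on [0,1] at its right endpoint is exactly a left limit at 1, and
      the value there is already the stationary expectation.\<close>
    from continuous_on_expectation_quasi_periodic[OF this]
    have "((\<lambda>u. measure_pmf.expectation (quasi_periodic M N t a b u) f)
        \<longlongrightarrow> measure_pmf.expectation (quasi_periodic M N t a b 1) f) (at 1 within {0..1})"
      by (simp add: continuous_on_def)
    then show "((\<lambda>u. measure_pmf.expectation (quasi_periodic M N t a b u) f)
        \<longlongrightarrow> measure_pmf.expectation (quasi_periodic M N t a b 1) f) (at_left 1)"
      by (simp add: at_within_Icc_at_left)
  qed
qed

end
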